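(* For every $\tau\in\mathbb{H}^2$, $$\theta'[\tfrac23,0]=-\frac13\,\frac{\theta'[1,1]\,\theta^3[\frac13,1]}{\theta^2[\frac23,0]\,\theta[0,0]}\qquad\text{and}\qquad \theta'[\tfrac23,1]=\frac13\,\frac{\theta'[1,1]\,\theta^3[\frac13,1]}{\theta^2[\frac23,1]\,\theta[0,1]}.$$
   Context: $\mathbb{H}^2=\{\tau\in\mathbb{C} : \Im\tau>0\}$ is the upper half plane. For $\epsilon,\epsilon'\in\mathbb{R}$, $\zeta\in\mathbb{C}$, $\tau\in\mathbb{H}^2$, the theta function with characteristics is $$\theta[\epsilon,\epsilon'](\zeta,\tau)=\sum_{n\in\mathbb{Z}}\exp\left(2\pi i\left[\tfrac12\left(n+\tfrac{\epsilon}{2}\right)^2\tau+\left(n+\tfrac{\epsilon}{2}\right)\left(\zeta+\tfrac{\epsilon'}{2}\right)\right]\right).$$ Write $\theta[\epsilon,\epsilon']=\theta[\epsilon,\epsilon'](0,\tau)$ and $\theta'[\epsilon,\epsilon']=\frac{\partial}{\partial\zeta}\theta[\epsilon,\epsilon'](\zeta,\tau)\big|_{\zeta=0}$; $\theta^k[\epsilon,\epsilon']$ means the $k$-th power of $\theta[\epsilon,\epsilon']$. *)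

theory Defs
  imports "HOL-Analysis.Analysis"
begin

definition theta :: "real \<Rightarrow> real \<Rightarrow> complex \<Rightarrow> complex \<Rightarrow> complex" where
  "theta \<epsilon> \<epsilon>' \<zeta> \<tau> =
     (\<Sum>\<^sub>\<infinity>n::int. exp (2 * of_real pi * \<i> *
        (1/2 * (of_int n + of_real \<epsilon> / 2)\<^sup>2 * \<tau>
         + (of_int n + of_real \<epsilon> / 2) * (\<zeta> + of_real \<epsilon>' / 2))))"

definition theta_const :: "real \<Rightarrow> real \<Rightarrow> complex \<Rightarrow> complex" where
  "theta_const \<epsilon> \<epsilon>' \<tau> = theta \<epsilon> \<epsilon>' 0 \<tau>"

definition theta_deriv :: "real \<Rightarrow> real \<Rightarrow> complex \<Rightarrow> complex" where
  "theta_deriv \<epsilon> \<epsilon>' \<tau> = deriv (\<lambda>\<zeta>. theta \<epsilon> \<epsilon>' \<zeta> \<tau>) 0"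

end

theory Submission
  imports Defs "HOL-Complex_Analysis.Cauchy_Integral_Formula"
begin

text \<open>
  Both formulas are specialisations of one identity for the odd function $f(\zeta) =
  \theta[1,1](\zeta,\tau)$, which plays the part of the Weierstrass sigma function:
  \[ f'(0)\, f(2a)^3 = 3 f'(a) f(a)^2 f(3a) - f(a)^3 f'(3a), \]
  in Weierstrass's notation $3\zeta(a) - \zeta(3a) = \sigma(2a)^3 / (\sigma(a)^3 \sigma(3a))$.
  If $a = ((\epsilon - 1)\tau + (\epsilon' - 1))/2$, then $f$ at
  $a$, $2a$ and $3a$ is, up to exponential factors, the theta constant with characteristics
  $[\epsilon,\epsilon']$, $[2\epsilon-1,2\epsilon'-1]$ and $[3\epsilon-2,3\epsilon'-2]$. The exponential
  factors cancel, which gives \<open>theta_const_triplication\<close>. For $\epsilon = 2/3$ the last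
  characteristic is $[0,\epsilon']$ up to periods with $\epsilon' \in \{0,1\}$; that theta function is
  even, so its derivative at $0$ vanishes and the identity can be solved for
  $\theta'[2/3,\epsilon']$. The sign in the first formula comes from
  $\theta[1/3,1]^3 = -\theta[1/3,-1]^3$.

  The identity for $f$ is the derivative of the three-term relation. That relation is plain linear
  algebra once $f(x+y) f(x-y)$ is known to be a $2 \times 2$ determinant $A(x)B(y) - B(x)A(y)$: it is
  the Pluecker relation between such determinants. The determinant comes from summing the product of
  two theta series over the two parity classes of pairs of integers
  (\<open>theta_mult_theta\<close>).

  The divisions also require the theta constants in the denominators to be nonzero. This follows
  from the same product formula: it expresses $\theta[0,0](z+1/2,\tau)\,\theta[0,0](z,\tau)$ as a
  product of two values at $2\tau$, so a zero for $\tau$ would produce zeros for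
  $2\tau, 4\tau, \ldots$, whereas for large $\Im\tau$ the term $n = 0$ dominates the series.
\<close>

section \<open>Sums over the integers\<close>

lemma has_sum_geometric_int:
  fixes r :: real
  assumes "0 \<le> r" "r < 1"
  shows "((\<lambda>n::int. r ^ nat \<bar>n\<bar>) has_sum (1 + r) / (1 - r)) UNIV"
proof -
  have geo: "((\<lambda>k::nat. r ^ k) has_sum 1 / (1 - r)) UNIV"
    using assms by (intro norm_summable_imp_has_sum geometric_sums) auto
  have "(((\<lambda>n::int. r ^ nat \<bar>n\<bar>) \<circ> int) has_sum 1 / (1 - r)) UNIV"
    using geo by (simp add: o_def)
  then have pos: "((\<lambda>n::int. r ^ nat \<bar>n\<bar>) has_sum 1 / (1 - r)) (range int)"
    by (subst has_sum_reindex) auto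
  have inj: "inj (\<lambda>k::nat. - 1 - int k)"
    by (auto simp: inj_def)
  have "nat \<bar>- 1 - int k\<bar> = Suc k" for k
    by auto
  then have "(((\<lambda>n::int. r ^ nat \<bar>n\<bar>) \<circ> (\<lambda>k::nat. - 1 - int k)) has_sum r * (1 / (1 - r))) UNIV"
    using has_sum_cmult_right[OF geo, of r] by (simp add: o_def del: abs_minus_cancel)
  then have neg: "((\<lambda>n::int. r ^ nat \<bar>n\<bar>) has_sum r * (1 / (1 - r))) (range (\<lambda>k::nat. - 1 - int k))"
    using has_sum_reindex[OF inj] by blast
  have disj: "range int \<inter> range (\<lambda>k::nat. - 1 - int k) = {}"
    by auto
  have "n \<in> range int \<union> range (\<lambda>k::nat. - 1 - int k)" for n :: int
  proof (cases "n \<ge> 0")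
    case True
    then show ?thesis by (metis UnI1 nat_0_le rangeI)
  next
    case False
    then have "n = - 1 - int (nat (- 1 - n))" by auto
    then show ?thesis by blast
  qed
  then have un: "range int \<union> range (\<lambda>k::nat. - 1 - int k) = UNIV"
    by blast
  have "1 / (1 - r) + r * (1 / (1 - r)) = (1 + r) / (1 - r)"
    by (simp add: add_divide_distrib)
  then show ?thesis
    using has_sum_Un_disjoint[OF pos neg disj] un by simp
qed

lemma abs_summable_on_mult_pairs:
  fixes f :: "'a \<Rightarrow> complex" and g :: "'b \<Rightarrow> complex"
  assumes "(\<lambda>m. norm (f m)) summable_on A" "(\<lambda>n. norm (g n)) summable_on B"
  shows "(\<lambda>p. norm (case p of (m, n) \<Rightarrow> f m * g n)) summable_on A \<times> B"
  unfolding Infinite_Sum.abs_summable_on_Sigma_iff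
  using assms
  by (auto simp: norm_mult infsum_cmult_right' abs_mult intro!: summable_on_cmult_right summable_on_cmult_left)

lemma infsum_mult_pairs:
  fixes f :: "'a \<Rightarrow> complex" and g :: "'b \<Rightarrow> complex"
  assumes "(\<lambda>m. norm (f m)) summable_on A" "(\<lambda>n. norm (g n)) summable_on B"
  shows "infsum f A * infsum g B = infsum (\<lambda>(m, n). f m * g n) (A \<times> B)"
  using abs_summable_summable[OF abs_summable_on_mult_pairs[OF assms]]
  by (simp flip: infsum_Sigma'_banach add: infsum_cmult_right' infsum_cmult_left')

text \<open>
  The substitution $m = r + s$, $n = r - s$ diagonalises $m^2 + n^2$, but reaches only the pairs with
  $m + n$ even; the odd pairs form the second summand.
\<close>
lemma infsum_int_pairs_by_parity:
  fixes h :: "int \<times> int \<Rightarrow> complex"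
  assumes "h summable_on UNIV"
  shows "infsum h UNIV = infsum (\<lambda>(r, s). h (r + s, r - s)) UNIV
                       + infsum (\<lambda>(r, s). h (r + s + 1, r - s)) UNIV"
proof -
  define E where "E = {(m, n). even (m + n :: int)}"
  have bijE: "bij_betw (\<lambda>(r, s). (r + s, r - s)) UNIV E"
  proof (rule bij_betwI[where g = "\<lambda>(m, n). ((m + n) div 2, (m - n) div 2)"])
    show "(\<lambda>(r, s). (r + s, r - s)) (case p of (m, n) \<Rightarrow> ((m + n) div 2, (m - n) div 2)) = p"
      if "p \<in> E" for p
      using that by (cases p) (simp add: E_def, presburger)
  qed (auto simp: E_def)
  have bijO: "bij_betw (\<lambda>(r, s). (r + s + 1, r - s)) UNIV (- E)"
  proof (rule bij_betwI[where g = "\<lambda>(m, n). ((m + n) div 2, (m - n) div 2)"])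
    show "(\<lambda>(r, s). (r + s + 1, r - s)) (case p of (m, n) \<Rightarrow> ((m + n) div 2, (m - n) div 2)) = p"
      if "p \<in> - E" for p
      using that by (cases p) (simp add: E_def, presburger)
  qed (auto simp: E_def)
  have "infsum h UNIV = infsum h E + infsum h (- E)"
    using infsum_Un_disjoint[of h E "- E"] assms
    by (simp add: summable_on_subset_banach)
  also have "infsum h E = infsum (\<lambda>p. h (case p of (r, s) \<Rightarrow> (r + s, r - s))) UNIV"
    by (rule infsum_reindex_bij_betw[OF bijE, symmetric])
  also have "infsum h (- E) = infsum (\<lambda>p. h (case p of (r, s) \<Rightarrow> (r + s + 1, r - s))) UNIV"
    by (rule infsum_reindex_bij_betw[OF bijO, symmetric])
  finally show ?thesis
    by (simp add: case_prod_unfold)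
qed

section \<open>The theta series\<close>

text \<open>
  The summand is named so that manipulations of the series reduce to identities between exponents.
\<close>
definition theta_term :: "real \<Rightarrow> real \<Rightarrow> complex \<Rightarrow> complex \<Rightarrow> int \<Rightarrow> complex" where
  "theta_term \<epsilon> \<epsilon>' \<zeta> \<tau> n = exp (2 * of_real pi * \<i> *
        (1/2 * (of_int n + of_real \<epsilon> / 2)\<^sup>2 * \<tau>
         + (of_int n + of_real \<epsilon> / 2) * (\<zeta> + of_real \<epsilon>' / 2)))"

lemma theta_eq_infsum: "theta \<epsilon> \<epsilon>' \<zeta> \<tau> = infsum (theta_term \<epsilon> \<epsilon>' \<zeta> \<tau>) UNIV"
  unfolding theta_def theta_term_def ..

lemma norm_theta_term:
  "norm (theta_term \<epsilon> \<epsilon>' \<zeta> \<tau> n) =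
     exp (- pi * Im \<tau> * (of_int n + \<epsilon> / 2)\<^sup>2 - 2 * pi * (of_int n + \<epsilon> / 2) * Im \<zeta>)"
proof -
  define \<nu> where "\<nu> = of_int n + \<epsilon> / 2"
  have "(of_int n + of_real \<epsilon> / 2 :: complex) = of_real \<nu>"
    by (simp add: \<nu>_def)
  then show ?thesis
    unfolding theta_term_def \<nu>_def[symmetric]
    by (simp add: algebra_simps flip: of_real_power)
qed

text \<open>
  A majorant uniform for $\zeta$ in horizontal strips. With $\nu = n + \epsilon/2$ it is obtained by
  completing the square in $-\pi\,\Im\tau\,\nu^2 + (2 \pi R + 1)|\nu|$; the extra $|\nu|$ is what
  leaves the geometric decay $e^{-|n|}$.
\<close>
lemma norm_theta_term_le:
  assumes "Im \<tau> > 0" "\<bar>Im \<zeta>\<bar> \<le> R"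
  shows "norm (theta_term \<epsilon> \<epsilon>' \<zeta> \<tau> n) \<le>
           exp ((2 * pi * R + 1)\<^sup>2 / (4 * pi * Im \<tau>) + \<bar>\<epsilon>\<bar> / 2) * exp (- 1) ^ nat \<bar>n\<bar>"
proof -
  define \<nu> T where "\<nu> = of_int n + \<epsilon> / 2" and "T = pi * Im \<tau>"
  have "T > 0" using assms by (simp add: T_def)
  have "- 2 * pi * \<nu> * Im \<zeta> \<le> 2 * pi * R * \<bar>\<nu>\<bar>"
  proof -
    have "\<bar>\<nu> * Im \<zeta>\<bar> \<le> \<bar>\<nu>\<bar> * R"
      using assms by (simp add: abs_mult mult_left_mono)
    then have "2 * pi * (- (\<nu> * Im \<zeta>)) \<le> 2 * pi * (\<bar>\<nu>\<bar> * R)"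
      by (intro mult_left_mono) auto
    then show ?thesis by (simp add: algebra_simps)
  qed
  moreover have "(2 * pi * R + 1) * \<bar>\<nu>\<bar> - T * \<nu>\<^sup>2 \<le> (2 * pi * R + 1)\<^sup>2 / (4 * T)"
  proof -
    define c where "c = 2 * pi * R + 1"
    have "0 \<le> (2 * T * \<bar>\<nu>\<bar> - c)\<^sup>2" by simp
    then have "(c * \<bar>\<nu>\<bar> - T * \<nu>\<^sup>2) * (4 * T) \<le> c\<^sup>2"
      by (simp add: power2_eq_square algebra_simps)
    then show ?thesis
      using \<open>T > 0\<close> unfolding c_def[symmetric] by (simp add: pos_le_divide_eq)
  qed
  moreover have "\<bar>of_int n\<bar> - \<bar>\<epsilon>\<bar> / 2 \<le> \<bar>\<nu>\<bar>"
    unfolding \<nu>_def by linarith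
  ultimately have "- T * \<nu>\<^sup>2 - 2 * pi * \<nu> * Im \<zeta>
        \<le> (2 * pi * R + 1)\<^sup>2 / (4 * T) + \<bar>\<epsilon>\<bar> / 2 - \<bar>of_int n\<bar>"
    by (simp add: algebra_simps)
  then have "norm (theta_term \<epsilon> \<epsilon>' \<zeta> \<tau> n)
        \<le> exp ((2 * pi * R + 1)\<^sup>2 / (4 * T) + \<bar>\<epsilon>\<bar> / 2 - \<bar>of_int n\<bar>)"
    by (simp add: norm_theta_term \<nu>_def T_def)
  also have "\<dots> = exp ((2 * pi * R + 1)\<^sup>2 / (4 * T) + \<bar>\<epsilon>\<bar> / 2) * exp (- 1) ^ nat \<bar>n\<bar>"
  proof -
    have "exp (- 1) ^ nat \<bar>n\<bar> = exp (- \<bar>of_int n\<bar> :: real)"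
      by (simp flip: exp_of_nat_mult)
    then show ?thesis
      by (simp flip: exp_add)
  qed
  finally show ?thesis by (simp add: T_def mult.assoc)
qed

lemma summable_theta_majorant: "(\<lambda>n::int. C * exp (- 1 :: real) ^ nat \<bar>n\<bar>) summable_on UNIV"
  using has_sum_geometric_int[of "exp (- 1)"]
  by (intro summable_on_cmult_right) (auto simp: summable_on_def)

lemma theta_term_abs_summable:
  assumes "Im \<tau> > 0"
  shows "(\<lambda>n. norm (theta_term \<epsilon> \<epsilon>' \<zeta> \<tau> n)) summable_on UNIV"
  using norm_theta_term_le[OF assms order_refl, of \<epsilon> \<epsilon>' \<zeta>]
  by (intro Infinite_Sum.abs_summable_on_comparison_test
        [OF summable_on_iff_abs_summable_on_real[THEN iffD1, OF summable_theta_majorant]])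
     (auto intro: order_trans abs_ge_self)

lemma theta_holomorphic:
  assumes "Im \<tau> > 0"
  shows "(\<lambda>\<zeta>. theta \<epsilon> \<epsilon>' \<zeta> \<tau>) holomorphic_on UNIV"
proof -
  have "(\<lambda>\<zeta>. theta \<epsilon> \<epsilon>' \<zeta> \<tau>) holomorphic_on ball 0 R" for R
  proof (rule holomorphic_uniform_limit)
    show "uniform_limit (cball 0 R) (\<lambda>F \<zeta>. \<Sum>n\<in>F. theta_term \<epsilon> \<epsilon>' \<zeta> \<tau> n)
            (\<lambda>\<zeta>. theta \<epsilon> \<epsilon>' \<zeta> \<tau>) (finite_subsets_at_top UNIV)"
      unfolding theta_eq_infsum
    proof (rule Weierstrass_m_test_general[OF _ summable_theta_majorant])
      fix n :: int and \<zeta> :: complex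
      assume "\<zeta> \<in> cball 0 R"
      then have "\<bar>Im \<zeta>\<bar> \<le> R"
        using abs_Im_le_cmod[of \<zeta>] by simp
      then show "norm (theta_term \<epsilon> \<epsilon>' \<zeta> \<tau> n) \<le>
           exp ((2 * pi * R + 1)\<^sup>2 / (4 * pi * Im \<tau>) + \<bar>\<epsilon>\<bar> / 2) * exp (- 1) ^ nat \<bar>n\<bar>"
        by (rule norm_theta_term_le[OF assms])
    qed
    show "\<forall>\<^sub>F F in finite_subsets_at_top UNIV.
            continuous_on (cball 0 R) (\<lambda>\<zeta>. \<Sum>n\<in>F. theta_term \<epsilon> \<epsilon>' \<zeta> \<tau> n) \<and>
            (\<lambda>\<zeta>. \<Sum>n\<in>F. theta_term \<epsilon> \<epsilon>' \<zeta> \<tau> n) holomorphic_on ball 0 R"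
      unfolding theta_term_def
      by (intro always_eventually allI conjI continuous_intros holomorphic_intros)
  qed auto
  then have "(\<lambda>\<zeta>. theta \<epsilon> \<epsilon>' \<zeta> \<tau>) holomorphic_on (\<Union>R\<in>UNIV. ball 0 R)"
    by (intro holomorphic_on_UN_open) auto
  moreover have "(\<Union>R\<in>UNIV. ball 0 R) = (UNIV :: complex set)"
    by (auto simp: gt_ex)
  ultimately show ?thesis by simp
qed

lemma theta_has_field_derivative:
  assumes "Im \<tau> > 0"
  shows "((\<lambda>\<zeta>. theta \<epsilon> \<epsilon>' \<zeta> \<tau>) has_field_derivative deriv (\<lambda>\<zeta>. theta \<epsilon> \<epsilon>' \<zeta> \<tau>) z) (at z)"
  using holomorphic_derivI[OF theta_holomorphic[OF assms]] by simp

section \<open>Characteristics\<close>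

text \<open>
  Real characteristics are translations of the argument by $(\alpha\tau+\beta)/2$, up to an exponential
  factor; so all theta functions below are translates of $\theta[1,1]$ or of $\theta[0,0]$.
\<close>
lemma theta_shift:
  "theta (\<epsilon> + \<alpha>) (\<epsilon>' + \<beta>) \<zeta> \<tau> =
     exp (of_real pi * \<i> * ((of_real \<alpha>)\<^sup>2 * \<tau> / 4 + of_real \<alpha> * (\<zeta> + of_real (\<epsilon>' + \<beta>) / 2))) *
     theta \<epsilon> \<epsilon>' (\<zeta> + (of_real \<alpha> * \<tau> + of_real \<beta>) / 2) \<tau>"
proof -
  have "theta_term (\<epsilon> + \<alpha>) (\<epsilon>' + \<beta>) \<zeta> \<tau> n =
     exp (of_real pi * \<i> * ((of_real \<alpha>)\<^sup>2 * \<tau> / 4 + of_real \<alpha> * (\<zeta> + of_real (\<epsilon>' + \<beta>) / 2))) *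
     theta_term \<epsilon> \<epsilon>' (\<zeta> + (of_real \<alpha> * \<tau> + of_real \<beta>) / 2) \<tau> n" for n
    unfolding theta_term_def exp_add[symmetric]
    by (rule arg_cong[where f = exp]) (simp add: field_simps power2_eq_square)
  then show ?thesis
    unfolding theta_eq_infsum infsum_cmult_right'[symmetric] by (rule infsum_cong)
qed

lemma theta_minus: "theta \<epsilon> \<epsilon>' (- \<zeta>) \<tau> = theta (- \<epsilon>) (- \<epsilon>') \<zeta> \<tau>"
proof -
  have "theta_term \<epsilon> \<epsilon>' (- \<zeta>) \<tau> (- n) = theta_term (- \<epsilon>) (- \<epsilon>') \<zeta> \<tau> n" for n
    unfolding theta_term_def
    by (rule arg_cong[where f = exp]) (simp add: field_simps power2_eq_square)
  moreover have "bij (uminus :: int \<Rightarrow> int)"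
    by (rule bij_betwI[where g = uminus]) auto
  ultimately show ?thesis
    using infsum_reindex_bij_betw[of "uminus :: int \<Rightarrow> int" UNIV UNIV "theta_term \<epsilon> \<epsilon>' (- \<zeta>) \<tau>"]
    by (simp add: theta_eq_infsum)
qed

lemma theta_add_2_left: "theta (\<epsilon> + 2) \<epsilon>' \<zeta> \<tau> = theta \<epsilon> \<epsilon>' \<zeta> \<tau>"
proof -
  have "theta_term \<epsilon> \<epsilon>' \<zeta> \<tau> (n + 1) = theta_term (\<epsilon> + 2) \<epsilon>' \<zeta> \<tau> n" for n
    unfolding theta_term_def
    by (rule arg_cong[where f = exp]) (simp add: field_simps power2_eq_square)
  moreover have "bij (\<lambda>n::int. n + 1)"
    by (rule bij_betwI[where g = "\<lambda>n. n - 1"]) auto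
  ultimately show ?thesis
    using infsum_reindex_bij_betw[of "\<lambda>n::int. n + 1" UNIV UNIV "theta_term \<epsilon> \<epsilon>' \<zeta> \<tau>"]
    by (simp add: theta_eq_infsum)
qed

lemma theta_add_2_right:
  "theta \<epsilon> (\<epsilon>' + 2) \<zeta> \<tau> = exp (of_real pi * \<i> * of_real \<epsilon>) * theta \<epsilon> \<epsilon>' \<zeta> \<tau>"
proof -
  have "theta_term \<epsilon> (\<epsilon>' + 2) \<zeta> \<tau> n =
          exp (of_real pi * \<i> * of_real \<epsilon>) * theta_term \<epsilon> \<epsilon>' \<zeta> \<tau> n" for n
  proof -
    have "theta_term \<epsilon> (\<epsilon>' + 2) \<zeta> \<tau> n =
      exp (2 * of_int n * of_real pi * \<i>) * exp (of_real pi * \<i> * of_real \<epsilon>) * theta_term \<epsilon> \<epsilon>' \<zeta> \<tau> n"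
      unfolding theta_term_def exp_add[symmetric]
      by (rule arg_cong[where f = exp]) (simp add: field_simps)
    also have "exp (2 * of_int n * of_real pi * \<i>) = (1 :: complex)"
      by (auto simp: exp_eq_1)
    finally show ?thesis by simp
  qed
  then show ?thesis
    unfolding theta_eq_infsum infsum_cmult_right'[symmetric] by (rule infsum_cong)
qed

section \<open>Products of two theta functions\<close>

text \<open>
  With $\mu, \nu \in \mathbb{Z} + \epsilon/2$ the summation variables of the two factors, the new variables
  $r = (\mu+\nu)/2$ and $s = (\mu-\nu)/2$ satisfy $\mu^2+\nu^2 = 2(r^2+s^2)$, hence the modulus
  $2\tau$, and decouple $x$ from $y$. Here $s$ is an integer on the pairs of even sum and a proper
  half-integer on the others, where $r$ is shifted by $1/2$ as well.
\<close>
lemma theta_mult_theta: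
  assumes "Im \<tau> > 0"
  shows "theta \<epsilon> \<epsilon>' (x + y) \<tau> * theta \<epsilon> \<epsilon>' (x - y) \<tau> =
           theta \<epsilon> (2 * \<epsilon>') (2 * x) (2 * \<tau>) * theta 0 0 (2 * y) (2 * \<tau>) +
           theta (\<epsilon> + 1) (2 * \<epsilon>') (2 * x) (2 * \<tau>) * theta 1 0 (2 * y) (2 * \<tau>)"
proof -
  define h where "h = (\<lambda>(m, n). theta_term \<epsilon> \<epsilon>' (x + y) \<tau> m * theta_term \<epsilon> \<epsilon>' (x - y) \<tau> n)"
  have sum1: "(\<lambda>n. norm (theta_term a b z \<tau> n)) summable_on UNIV"
    and sum2: "(\<lambda>n. norm (theta_term a b z (2 * \<tau>) n)) summable_on UNIV" for a b z
    using assms by (auto intro!: theta_term_abs_summable)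
  have even: "h (r + s, r - s) =
      theta_term \<epsilon> (2 * \<epsilon>') (2 * x) (2 * \<tau>) r * theta_term 0 0 (2 * y) (2 * \<tau>) s" for r s
    unfolding h_def theta_term_def exp_add[symmetric] prod.case
    by (rule arg_cong[where f = exp]) (simp add: field_simps power2_eq_square)
  have odd: "h (r + s + 1, r - s) =
      theta_term (\<epsilon> + 1) (2 * \<epsilon>') (2 * x) (2 * \<tau>) r * theta_term 1 0 (2 * y) (2 * \<tau>) s" for r s
    unfolding h_def theta_term_def exp_add[symmetric] prod.case
    by (rule arg_cong[where f = exp]) (simp add: field_simps power2_eq_square)
  have "h summable_on UNIV \<times> UNIV"
    unfolding h_def by (rule abs_summable_summable[OF abs_summable_on_mult_pairs[OF sum1 sum1]])
  moreover have "theta \<epsilon> \<epsilon>' (x + y) \<tau> * theta \<epsilon> \<epsilon>' (x - y) \<tau> = infsum h (UNIV \<times> UNIV)"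
    unfolding theta_eq_infsum h_def by (rule infsum_mult_pairs[OF sum1 sum1])
  ultimately have "theta \<epsilon> \<epsilon>' (x + y) \<tau> * theta \<epsilon> \<epsilon>' (x - y) \<tau> =
      infsum (\<lambda>(r, s). h (r + s, r - s)) UNIV + infsum (\<lambda>(r, s). h (r + s + 1, r - s)) UNIV"
    using infsum_int_pairs_by_parity[of h] by simp
  also have "(\<lambda>(r, s). h (r + s, r - s)) =
      (\<lambda>(r, s). theta_term \<epsilon> (2 * \<epsilon>') (2 * x) (2 * \<tau>) r * theta_term 0 0 (2 * y) (2 * \<tau>) s)"
    by (simp add: even)
  also have "infsum \<dots> UNIV =
      theta \<epsilon> (2 * \<epsilon>') (2 * x) (2 * \<tau>) * theta 0 0 (2 * y) (2 * \<tau>)"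
    unfolding theta_eq_infsum by (subst infsum_mult_pairs[OF sum2 sum2]) simp
  also have "(\<lambda>(r, s). h (r + s + 1, r - s)) =
      (\<lambda>(r, s). theta_term (\<epsilon> + 1) (2 * \<epsilon>') (2 * x) (2 * \<tau>) r * theta_term 1 0 (2 * y) (2 * \<tau>) s)"
    by (simp add: odd)
  also have "infsum \<dots> UNIV =
      theta (\<epsilon> + 1) (2 * \<epsilon>') (2 * x) (2 * \<tau>) * theta 1 0 (2 * y) (2 * \<tau>)"
    unfolding theta_eq_infsum by (subst infsum_mult_pairs[OF sum2 sum2]) simp
  finally show ?thesis .
qed


section \<open>The odd theta function\<close>

lemma theta_1_1_minus: "theta 1 1 (- \<zeta>) \<tau> = - theta 1 1 \<zeta> \<tau>"
  using theta_add_2_left[of "- 1" "- 1" \<zeta> \<tau>] theta_add_2_right[of 1 "- 1" \<zeta> \<tau>]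
  by (simp add: theta_minus)

lemma theta_1_1_mult:
  assumes "Im \<tau> > 0"
  shows "theta 1 1 (x + y) \<tau> * theta 1 1 (x - y) \<tau> =
           theta 0 0 (2 * x) (2 * \<tau>) * theta 1 0 (2 * y) (2 * \<tau>) -
           theta 1 0 (2 * x) (2 * \<tau>) * theta 0 0 (2 * y) (2 * \<tau>)"
proof -
  have "theta 1 2 (2 * x) (2 * \<tau>) = - theta 1 0 (2 * x) (2 * \<tau>)"
    using theta_add_2_right[of 1 0 "2 * x" "2 * \<tau>"] by simp
  moreover have "theta 2 2 (2 * x) (2 * \<tau>) = theta 0 0 (2 * x) (2 * \<tau>)"
    using theta_add_2_left[of 0 2 "2 * x" "2 * \<tau>"] theta_add_2_right[of 0 0 "2 * x" "2 * \<tau>"]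
    by simp
  ultimately show ?thesis
    using theta_mult_theta[OF assms, of 1 1 x y] by simp
qed

text \<open>
  By \<open>theta_1_1_mult\<close> each $f(x+y)f(x-y)$ is the minor of columns $x$ and $y$ of a
  matrix with two rows; this is the Pluecker relation among the six minors for $x, y, z, w$.
\<close>
lemma theta_1_1_three_term:
  assumes "Im \<tau> > 0"
  shows "theta 1 1 (x + y) \<tau> * theta 1 1 (x - y) \<tau> * (theta 1 1 (z + w) \<tau> * theta 1 1 (z - w) \<tau>) =
         theta 1 1 (x + z) \<tau> * theta 1 1 (x - z) \<tau> * (theta 1 1 (y + w) \<tau> * theta 1 1 (y - w) \<tau>) -
         theta 1 1 (x + w) \<tau> * theta 1 1 (x - w) \<tau> * (theta 1 1 (y + z) \<tau> * theta 1 1 (y - z) \<tau>)"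
  unfolding theta_1_1_mult[OF assms] by (simp add: algebra_simps)

text \<open>
  The three-term relation at $(x,y,z,w) = (a+t,\, a,\, 0,\, 2a)$ has a left-hand side with the factor
  $f(t)$, which vanishes at $t = 0$. Comparing derivatives in $t$ at $0$ therefore isolates $f'(0)$
  there, while the right-hand side involves only $f$ and $f'$ at $a$ and $3a$.
\<close>
lemma theta_1_1_triplication:
  fixes a :: complex
  assumes \<tau>: "Im \<tau> > 0"
  defines "f \<equiv> \<lambda>\<zeta>. theta 1 1 \<zeta> \<tau>"
  shows "deriv f 0 * f (2 * a) ^ 3 =
           3 * deriv f a * f a ^ 2 * f (3 * a) - f a ^ 3 * deriv f (3 * a)"
proof -
  have odd: "f (- \<zeta>) = - f \<zeta>" for \<zeta>
    unfolding f_def by (rule theta_1_1_minus)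
  have f0: "f 0 = 0"
    using odd[of 0] by simp
  have der: "(f has_field_derivative deriv f z) (at z)" for z
    unfolding f_def by (rule theta_has_field_derivative[OF \<tau>])
  have shifted: "((\<lambda>t. f (z + t)) has_field_derivative deriv f z) (at 0)" for z
    using der[of "0 + z"] unfolding DERIV_shift by (simp add: add.commute)
  have reflected: "((\<lambda>t. f (a - t)) has_field_derivative - deriv f a) (at 0)"
  proof -
    have "((\<lambda>t. a - t) has_field_derivative - 1) (at 0)"
      by (auto intro!: derivative_eq_intros)
    then show ?thesis
      using DERIV_chain2[of f "deriv f a" "\<lambda>t. a - t" 0 "- 1" UNIV] der[of a] by simp
  qed
  \<comment> \<open>Oddness has been used to turn every argument that occurs with a minus sign around.\<close>
  have eq: "f (2 * a + t) * f t * (f (2 * a) * f (2 * a)) =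
        f (a + t) * f (a + t) * (f (3 * a) * f a) - f (3 * a + t) * f (a - t) * (f a * f a)" for t
  proof -
    have args: "a + t + a = 2 * a + t" "a + t - a = t" "a + t + 2 * a = 3 * a + t"
        "a + t - 2 * a = - (a - t)" "a + 2 * a = 3 * a" "a - 2 * a = - a"
      by (simp_all add: algebra_simps)
    have "f (a + t + a) * f (a + t - a) * (f (0 + 2 * a) * f (0 - 2 * a)) =
        f (a + t + 0) * f (a + t - 0) * (f (a + 2 * a) * f (a - 2 * a)) -
        f (a + t + 2 * a) * f (a + t - 2 * a) * (f (a + 0) * f (a - 0))"
      unfolding f_def by (rule theta_1_1_three_term[OF \<tau>])
    then show ?thesis
      unfolding args add_0 add_0_right diff_0 diff_0_right odd by (simp add: algebra_simps)
  qed
  have lhs: "((\<lambda>t. f (2 * a + t) * f (0 + t) * (f (2 * a) * f (2 * a)))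
        has_field_derivative deriv f 0 * f (2 * a) ^ 3) (at 0)"
    by (rule DERIV_cong[OF DERIV_cmult_right[OF DERIV_mult[OF shifted shifted]]])
       (simp add: f0 power3_eq_cube)
  have rhs: "((\<lambda>t. f (a + t) * f (a + t) * (f (3 * a) * f a) - f (3 * a + t) * f (a - t) * (f a * f a))
        has_field_derivative 3 * deriv f a * f a ^ 2 * f (3 * a) - f a ^ 3 * deriv f (3 * a)) (at 0)"
    by (rule DERIV_cong[OF DERIV_diff[OF DERIV_cmult_right[OF DERIV_mult[OF shifted shifted]]
              DERIV_cmult_right[OF DERIV_mult[OF shifted reflected]]]])
       (simp add: power3_eq_cube power2_eq_square algebra_simps)
  show ?thesis
    using DERIV_unique[OF lhs] rhs by (simp add: eq)
qed

section \<open>The triplication formula for theta constants\<close>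

lemma theta_const_shift:
  "theta_const (\<epsilon> + \<alpha>) (\<epsilon>' + \<beta>) \<tau> =
     exp (of_real pi * \<i> * ((of_real \<alpha>)\<^sup>2 * \<tau> / 4 + of_real \<alpha> * of_real (\<epsilon>' + \<beta>) / 2)) *
     theta \<epsilon> \<epsilon>' ((of_real \<alpha> * \<tau> + of_real \<beta>) / 2) \<tau>"
  unfolding theta_const_def theta_shift by simp

lemma theta_deriv_shift:
  assumes "Im \<tau> > 0"
  shows "theta_deriv (\<epsilon> + \<alpha>) (\<epsilon>' + \<beta>) \<tau> =
     exp (of_real pi * \<i> * ((of_real \<alpha>)\<^sup>2 * \<tau> / 4 + of_real \<alpha> * of_real (\<epsilon>' + \<beta>) / 2)) *
     (of_real pi * \<i> * of_real \<alpha> * theta \<epsilon> \<epsilon>' ((of_real \<alpha> * \<tau> + of_real \<beta>) / 2) \<tau> +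
      deriv (\<lambda>\<zeta>. theta \<epsilon> \<epsilon>' \<zeta> \<tau>) ((of_real \<alpha> * \<tau> + of_real \<beta>) / 2))"
proof -
  define s where "s = (of_real \<alpha> * \<tau> + of_real \<beta>) / 2"
  define E where "E = (\<lambda>\<zeta>. exp (of_real pi * \<i> *
      ((of_real \<alpha>)\<^sup>2 * \<tau> / 4 + of_real \<alpha> * (\<zeta> + of_real (\<epsilon>' + \<beta>) / 2))))"
  have theta: "((\<lambda>\<zeta>. theta \<epsilon> \<epsilon>' (\<zeta> + s) \<tau>)
           has_field_derivative deriv (\<lambda>\<zeta>. theta \<epsilon> \<epsilon>' \<zeta> \<tau>) s) (at 0)"
    using theta_has_field_derivative[OF assms, of \<epsilon> \<epsilon>' "0 + s"] unfolding DERIV_shift by simp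
  have E: "(E has_field_derivative of_real pi * \<i> * of_real \<alpha> * E 0) (at 0)"
    unfolding E_def by (auto intro!: derivative_eq_intros)
  have "theta_deriv (\<epsilon> + \<alpha>) (\<epsilon>' + \<beta>) \<tau> = deriv (\<lambda>\<zeta>. E \<zeta> * theta \<epsilon> \<epsilon>' (\<zeta> + s) \<tau>) 0"
    unfolding theta_deriv_def theta_shift s_def E_def ..
  also have "\<dots> = E 0 * (of_real pi * \<i> * of_real \<alpha> * theta \<epsilon> \<epsilon>' s \<tau> + deriv (\<lambda>\<zeta>. theta \<epsilon> \<epsilon>' \<zeta> \<tau>) s)"
    using DERIV_imp_deriv[OF DERIV_mult[OF E theta]] by (simp add: distrib_left mult_ac)
  finally show ?thesis
    by (simp add: E_def s_def)
qed

text \<open>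
  The case of \<open>theta_1_1_triplication\<close> where $a$ is the vector that translates
  $[1,1]$ to $[\epsilon,\epsilon']$. The linear terms that the exponential factors contribute to the two
  derivatives on the right cancel because the factor at $3a$ has three times the slope of the factor
  at $a$.
\<close>
lemma theta_const_triplication:
  assumes "Im \<tau> > 0"
  shows "theta_deriv 1 1 \<tau> * theta_const (2 * \<epsilon> - 1) (2 * \<epsilon>' - 1) \<tau> ^ 3 =
           3 * theta_deriv \<epsilon> \<epsilon>' \<tau> * theta_const \<epsilon> \<epsilon>' \<tau> ^ 2 * theta_const (3 * \<epsilon> - 2) (3 * \<epsilon>' - 2) \<tau>
           - theta_const \<epsilon> \<epsilon>' \<tau> ^ 3 * theta_deriv (3 * \<epsilon> - 2) (3 * \<epsilon>' - 2) \<tau>"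
proof -
  define f where "f = (\<lambda>\<zeta>. theta 1 1 \<zeta> \<tau>)"
  define \<alpha> \<beta> where "\<alpha> = \<epsilon> - 1" and "\<beta> = \<epsilon>' - 1"
  define a where "a = (of_real \<alpha> * \<tau> + of_real \<beta>) / 2"
  define c where "c = of_real pi * \<i> * of_real \<alpha>"
  define e where "e k = exp (of_real pi * \<i> *
      ((of_real (k * \<alpha>))\<^sup>2 * \<tau> / 4 + of_real (k * \<alpha>) * of_real (1 + k * \<beta>) / 2))" for k
  have const: "theta_const (1 + k * \<alpha>) (1 + k * \<beta>) \<tau> = e k * f (of_real k * a)" for k
    unfolding theta_const_shift e_def f_def a_def by (simp add: algebra_simps)
  have deriv: "theta_deriv (1 + k * \<alpha>) (1 + k * \<beta>) \<tau> =
      e k * (of_real k * c * f (of_real k * a) + deriv f (of_real k * a))" for k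
    unfolding theta_deriv_shift[OF assms] e_def f_def a_def c_def by (simp add: algebra_simps)
  have args: "1 + 1 * \<alpha> = \<epsilon>" "1 + 1 * \<beta> = \<epsilon>'" "1 + 2 * \<alpha> = 2 * \<epsilon> - 1" "1 + 2 * \<beta> = 2 * \<epsilon>' - 1"
      "1 + 3 * \<alpha> = 3 * \<epsilon> - 2" "1 + 3 * \<beta> = 3 * \<epsilon>' - 2"
    by (simp_all add: \<alpha>_def \<beta>_def)
  \<comment> \<open>Both sides have the exponent $\pi i (3 \alpha^2 \tau + 3 \alpha (2 \beta + 1))$.\<close>
  have e: "e 2 ^ 3 = e 1 ^ 3 * e 3"
    unfolding e_def exp_of_nat_mult[symmetric] exp_add[symmetric]
    by (rule arg_cong[where f = exp]) (simp add: field_simps power2_eq_square)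
  have "deriv f 0 * (e 2 * f (2 * a)) ^ 3 =
      e 1 ^ 3 * e 3 * (3 * deriv f a * f a ^ 2 * f (3 * a) - f a ^ 3 * deriv f (3 * a))"
    using theta_1_1_triplication[OF assms, of a] by (simp add: f_def power_mult_distrib e)
  also have "\<dots> = 3 * (e 1 * (c * f a + deriv f a)) * (e 1 * f a) ^ 2 * (e 3 * f (3 * a))
      - (e 1 * f a) ^ 3 * (e 3 * (3 * c * f (3 * a) + deriv f (3 * a)))"
    by (simp add: power3_eq_cube power2_eq_square algebra_simps)
  also have "deriv f 0 = theta_deriv 1 1 \<tau>"
    by (simp add: f_def theta_deriv_def)
  finally show ?thesis
    using const[of 1] const[of 2] const[of 3] deriv[of 1] deriv[of 3] unfolding args by simp
qed

section \<open>Non-vanishing\<close>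

text \<open>
  For $|\Im z| \le \Im\tau/3$ the term of index $n$ is at most $r^{|n|}$ with $r = e^{-2\pi/3} < 1/3$,
  so the terms with $n \neq 0$ contribute at most $2r/(1-r) < 1$ and cannot cancel the term $1$ at
  $n = 0$.
\<close>
lemma theta_0_0_nonzero_of_large_Im:
  assumes "2 \<le> Im \<tau>" and "\<bar>Im z\<bar> \<le> Im \<tau> / 3"
  shows "theta 0 0 z \<tau> \<noteq> 0"
proof -
  define r where "r = exp (- (2 * pi / 3))"
  define t where "t = theta_term 0 0 z \<tau>"
  have "1 + 2 * pi / 3 \<le> exp (2 * pi / 3)"
    by (rule exp_ge_add_one_self)
  then have "3 < exp (2 * pi / 3)"
    using pi_gt3 by linarith
  then have r: "0 < r" "r < 1 / 3"
    by (auto simp: r_def exp_minus field_simps)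
  have majorant: "((\<lambda>n::int. r ^ nat \<bar>n\<bar>) has_sum (1 + r) / (1 - r)) UNIV"
    using r by (intro has_sum_geometric_int) auto
  have le: "norm (t n) \<le> r ^ nat \<bar>n\<bar>" for n
  proof -
    define k where "k = \<bar>of_int n :: real\<bar>"
    have "k = 0 \<or> 1 \<le> k"
      unfolding k_def by (cases "n = 0") (auto simp flip: of_int_abs)
    then have "k \<le> k\<^sup>2"
      by (auto intro: self_le_power)
    then have "Im \<tau> * k \<le> Im \<tau> * k\<^sup>2"
      using assms by (intro mult_left_mono) auto
    moreover have "- (of_int n * Im z) \<le> k * (Im \<tau> / 3)"
    proof -
      have "\<bar>of_int n * Im z\<bar> \<le> k * (Im \<tau> / 3)"
        unfolding abs_mult k_def using assms by (intro mult_left_mono) auto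
      then show ?thesis by linarith
    qed
    moreover have "2 * k \<le> Im \<tau> * k"
      using assms by (intro mult_right_mono) (auto simp: k_def)
    ultimately have "- (Im \<tau> * k\<^sup>2) - 2 * (of_int n * Im z) \<le> - (2 / 3 * k)"
      by (simp add: algebra_simps)
    then have "pi * (- (Im \<tau> * k\<^sup>2) - 2 * (of_int n * Im z)) \<le> pi * (- (2 / 3 * k))"
      by (intro mult_left_mono) auto
    then have "norm (t n) \<le> exp (- (2 * pi / 3) * k)"
      by (simp add: t_def norm_theta_term k_def algebra_simps)
    also have "\<dots> = r ^ nat \<bar>n\<bar>"
      by (simp add: r_def k_def algebra_simps flip: exp_of_nat_mult)
    finally show ?thesis .
  qed
  have sum: "(\<lambda>n. norm (t n)) summable_on UNIV"
    unfolding t_def using assms by (intro theta_term_abs_summable) auto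
  have split: "infsum g UNIV = g 0 + infsum g (- {0})"
    if "g summable_on UNIV" for g :: "int \<Rightarrow> 'b :: banach"
    using infsum_Un_disjoint[of g "{0}" "- {0}"] summable_on_subset_banach[OF that]
    by simp
  have "norm (infsum t (- {0})) \<le> infsum (\<lambda>n. norm (t n)) (- {0})"
    by (rule norm_infsum_bound) (rule summable_on_subset_banach[OF sum], simp)
  also have "\<dots> \<le> infsum (\<lambda>n. r ^ nat \<bar>n\<bar>) (- {0})"
    using majorant le
    by (intro infsum_mono summable_on_subset_banach[OF sum]
          summable_on_subset_banach[OF has_sum_imp_summable[OF majorant]]) auto
  also have "\<dots> = (1 + r) / (1 - r) - 1"
    using split[OF has_sum_imp_summable[OF majorant]] infsumI[OF majorant] by simp
  also have "\<dots> < 1"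
    using r by (simp add: field_simps)
  finally have "norm (infsum t (- {0})) < 1" .
  moreover have "theta 0 0 z \<tau> = 1 + infsum t (- {0})"
    using split[OF abs_summable_summable[OF sum]]
    by (simp add: theta_eq_infsum t_def theta_term_def[of 0 0 z \<tau> 0])
  ultimately show ?thesis
    by (metis add_eq_0_iff norm_minus_cancel norm_one less_irrefl)
qed

text \<open>
  The product formula at $x = z + 1/4$, $y = 1/4$; its second summand contains
  $\theta[1,0](1/2, 2\tau) = \theta[1,1](0, 2\tau) = 0$.
\<close>
lemma theta_0_0_doubling:
  assumes "Im \<tau> > 0"
  shows "theta 0 0 (z + 1/2) \<tau> * theta 0 0 z \<tau> =
           theta 0 0 (2 * z + 1/2) (2 * \<tau>) * theta 0 0 (1/2) (2 * \<tau>)"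
proof -
  have "theta 1 0 (1/2) (2 * \<tau>) = theta 1 1 0 (2 * \<tau>)"
    using theta_shift[of 1 0 0 1 0 "2 * \<tau>"] by simp
  also have "\<dots> = 0"
    using theta_1_1_minus[of 0 "2 * \<tau>"] by simp
  finally show ?thesis
    using theta_mult_theta[OF assms, of 0 0 "z + 1/4" "1/4"] by (simp add: algebra_simps)
qed

text \<open>
  The bound on $\Im z$ relative to $\Im\tau$ survives the step from $(z,\tau)$ to $(2z + 1/2, 2\tau)$
  and also holds for $(1/2, 2\tau)$; so by \<open>theta_0_0_doubling\<close> non-vanishing passes from
  $2\tau$ down to $\tau$, and doubling often enough reaches the range $\Im\tau \ge 2$.
\<close>
lemma theta_0_0_nonzero:
  assumes "Im \<tau> > 0" and "\<bar>Im z\<bar> \<le> Im \<tau> / 3"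
  shows "theta 0 0 z \<tau> \<noteq> 0"
proof -
  have *: "theta 0 0 z \<tau> \<noteq> 0"
    if "2 \<le> 2 ^ k * Im \<tau>" "Im \<tau> > 0" "\<bar>Im z\<bar> \<le> Im \<tau> / 3" for k z \<tau>
    using that
  proof (induction k arbitrary: z \<tau>)
    case 0
    then show ?case by (intro theta_0_0_nonzero_of_large_Im) auto
  next
    case (Suc k)
    have "theta 0 0 (2 * z + 1/2) (2 * \<tau>) \<noteq> 0" "theta 0 0 (1/2) (2 * \<tau>) \<noteq> 0"
      using Suc.prems by (intro Suc.IH; simp)+
    then show ?case
      using theta_0_0_doubling[OF Suc.prems(2), of z] by auto
  qed
  obtain k where "2 / Im \<tau> < 2 ^ k"
    using real_arch_pow[of 2 "2 / Im \<tau>"] by auto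
  then have "2 \<le> 2 ^ k * Im \<tau>"
    using assms by (simp add: field_simps)
  then show ?thesis
    using * assms by blast
qed

lemma theta_const_nonzero:
  assumes "Im \<tau> > 0" and "\<bar>\<epsilon>\<bar> \<le> 2/3"
  shows "theta_const \<epsilon> \<epsilon>' \<tau> \<noteq> 0"
proof -
  have "\<bar>\<epsilon>\<bar> * Im \<tau> \<le> 2/3 * Im \<tau>"
    using assms by (intro mult_right_mono) auto
  then have "theta 0 0 ((of_real \<epsilon> * \<tau> + of_real \<epsilon>') / 2) \<tau> \<noteq> 0"
    using assms by (intro theta_0_0_nonzero) (auto simp: abs_mult)
  then show ?thesis
    using theta_const_shift[of 0 \<epsilon> 0 \<epsilon>' \<tau>] by simp
qed

section \<open>The derivative formulas\<close>

lemma deriv_even_at_0: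
  fixes f :: "complex \<Rightarrow> complex"
  assumes "f field_differentiable at 0" "\<And>x. f (- x) = f x"
  shows "deriv f 0 = 0"
proof -
  have f: "(f has_field_derivative deriv f 0) (at 0)"
    using assms(1) by (simp add: field_differentiable_derivI)
  have minus: "((\<lambda>x. - x) has_field_derivative (- 1 :: complex)) (at 0)"
    by (auto intro!: derivative_eq_intros)
  have "((\<lambda>x. f (- x)) has_field_derivative deriv f 0 * (- 1)) (at 0)"
    using DERIV_chain2[OF _ minus, of f "deriv f 0"] f by simp
  then have "deriv f 0 = deriv f 0 * (- 1)"
    unfolding assms(2) by (rule DERIV_unique[OF f])
  then show ?thesis
    by simp
qed

lemma theta_deriv_0:
  assumes "Im \<tau> > 0" and even: "\<And>\<zeta>. theta 0 (- \<epsilon>') \<zeta> \<tau> = theta 0 \<epsilon>' \<zeta> \<tau>"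
  shows "theta_deriv 0 \<epsilon>' \<tau> = 0"
  unfolding theta_deriv_def
proof (rule deriv_even_at_0)
  show "(\<lambda>\<zeta>. theta 0 \<epsilon>' \<zeta> \<tau>) field_differentiable at 0"
    using theta_has_field_derivative[OF assms(1)] field_differentiable_def by blast
  show "theta 0 \<epsilon>' (- \<zeta>) \<tau> = theta 0 \<epsilon>' \<zeta> \<tau>" for \<zeta>
    using even by (simp add: theta_minus)
qed

text \<open>
  \<open>theta_const_triplication\<close> at $\epsilon = 2/3$ yields the theta constants
  $[1/3,-1]$ and $[0,-2]$ for $\epsilon' = 0$, which are reduced to $[1/3,1]$ and $[0,0]$, and already
  $[1/3,1]$ and $[0,1]$ for $\epsilon' = 1$.
\<close>
theorem theorem5p6:
  fixes \<tau> :: complex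
  assumes "Im \<tau> > 0"
  shows "theta_deriv (2/3) 0 \<tau> =
           - (1/3) * (theta_deriv 1 1 \<tau> * theta_const (1/3) 1 \<tau> ^ 3
                      / (theta_const (2/3) 0 \<tau> ^ 2 * theta_const 0 0 \<tau>))
       \<and> theta_deriv (2/3) 1 \<tau> =
           1/3 * (theta_deriv 1 1 \<tau> * theta_const (1/3) 1 \<tau> ^ 3
                  / (theta_const (2/3) 1 \<tau> ^ 2 * theta_const 0 1 \<tau>))"
proof
  have nonzero: "theta_const (2/3) \<epsilon>' \<tau> \<noteq> 0" "theta_const 0 \<epsilon>' \<tau> \<noteq> 0" for \<epsilon>'
    using assms by (intro theta_const_nonzero; simp)+
  have periodic: "theta 0 (\<epsilon>' + 2) \<zeta> \<tau> = theta 0 \<epsilon>' \<zeta> \<tau>" for \<epsilon>' \<zeta>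
    by (simp add: theta_add_2_right)
  have const_0: "theta_const 0 (- 2) \<tau> = theta_const 0 0 \<tau>"
    using periodic[of "- 2"] by (simp add: theta_const_def)
  have deriv_0: "theta_deriv 0 (- 2) \<tau> = 0" "theta_deriv 0 1 \<tau> = 0"
    using periodic[of "- 2"] periodic[of 0] periodic[of "- 1"] assms by (auto intro!: theta_deriv_0)
  have "theta_const (1/3) 1 \<tau> ^ 3 = exp (of_real pi * \<i> * (1/3)) ^ 3 * theta_const (1/3) (- 1) \<tau> ^ 3"
    using theta_add_2_right[of "1/3" "- 1" 0 \<tau>] by (simp add: theta_const_def power_mult_distrib)
  also have "exp (of_real pi * \<i> * (1/3)) ^ 3 = (- 1 :: complex)"
    by (simp flip: exp_of_nat_mult)
  finally have minus: "theta_const (1/3) 1 \<tau> ^ 3 = - (theta_const (1/3) (- 1) \<tau> ^ 3)"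
    by simp
  show "theta_deriv (2/3) 0 \<tau> =
          - (1/3) * (theta_deriv 1 1 \<tau> * theta_const (1/3) 1 \<tau> ^ 3
                      / (theta_const (2/3) 0 \<tau> ^ 2 * theta_const 0 0 \<tau>))"
    using theta_const_triplication[OF assms, of "2/3" 0] nonzero
    by (simp add: minus const_0 deriv_0 field_simps)
  show "theta_deriv (2/3) 1 \<tau> =
          1/3 * (theta_deriv 1 1 \<tau> * theta_const (1/3) 1 \<tau> ^ 3
                  / (theta_const (2/3) 1 \<tau> ^ 2 * theta_const 0 1 \<tau>))"
    using theta_const_triplication[OF assms, of "2/3" 1] nonzero
    by (simp add: deriv_0 field_simps)
qed

end
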